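(* Let $P\subset\mathbb{R}^m$, $\bar p\in P$, $F:\mathbb{R}^m\times\mathbb{R}^n\to\mathbb{R}^n$ continuously differentiable, and $\varphi=(\varphi_1,\dots,\varphi_{l_I}):\mathbb{R}^m\times\mathbb{R}^n\to\mathbb{R}^{l_I}$ of class $\mathcal C^2$. Set $G(p,x,y):=F(p,x)+\nabla_x\varphi(p,x)^Ty$, $g(p,x,y):=(G(p,x,y),(\varphi(p,x),y))$, $C:=\{0_{\mathbb{R}^n}\}\times\operatorname{gph}N_{\mathbb{R}^{l_I}_-}$, and $\Gamma(p):=\{(x,y)\in\mathbb{R}^n\times\mathbb{R}^{l_I}: g(p,x,y)\in C\}$ for $p\in P$. Let $(\bar x,\bar y)\in\Gamma(\bar p)$. Suppose that for every $w\in T_P(\bar p)$ there is $(u,v)\in\mathbb{R}^n\times\mathbb{R}^{l_I}$ with $$(\ast)\quad \nabla_pG(\bar p,\bar x,\bar y)w+\nabla_xG(\bar p,\bar x,\bar y)u+\nabla_x\varphi(\bar p,\bar x)^Tv=0,\quad (\nabla\varphi(\bar p,\bar x)(w,u),v)\in T_{\operatorname{gph}N_{\mathbb{R}^{l_I}_-}}((\varphi(\bar p,\bar x),\bar y)),$$ and that for every $(w,u,v)\ne(0,0,0)$ with $w\in T_P(\bar p)$ satisfying $(\ast)$ and every $(z,\lambda,d)\in\mathbb{R}^n\times\mathbb{R}^{l_I}\times\mathbb{R}^{l_I}$ the conditions $\nabla_xG(\bar p,\bar x,\bar y)^Tz+\nabla_x\varphi(\bar p,\bar x)^T\lambda=0$,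 $\nabla_x\varphi(\bar p,\bar x)z+d=0$, $(\lambda,d)\in N_{\operatorname{gph}N_{\mathbb{R}^{l_I}_-}}\big((\varphi(\bar p,\bar x),\bar y);(\nabla\varphi(\bar p,\bar x)(w,u),v)\big)$ imply $(z,\lambda)=(0,0)$. Then the system $g(p,x,y)\in C$, $p\in P$, enjoys Robinson stability at $(\bar p,(\bar x,\bar y))$, and $\Gamma$ is Lipschitz-like around $(\bar p,(\bar x,\bar y))$.
   Context: $\operatorname{gph}N_{\mathbb{R}^{l_I}_-}=\{(a,y)\in\mathbb{R}^{l_I}\times\mathbb{R}^{l_I}: a\le0,\ y\ge0,\ a_iy_i=0\ \forall i\}$ (graph of the normal cone mapping of the nonpositive orthant). $\nabla\varphi(\bar p,\bar x)(w,u)=\nabla_p\varphi(\bar p,\bar x)w+\nabla_x\varphi(\bar p,\bar x)u$. $T$ is the contingent cone; $N_\Omega(\bar z;w)=\{v:\exists t_k\downarrow0,w_k\to w,v_k\to v,\ \bar z+t_kw_k\in\Omega,\ v_k\in\widehat N_\Omega(\bar z+t_kw_k)\}$ the directional limiting normal cone ($\widehat N$ regular normal cone). Robinson stability at $(\bar p,\bar\xi)$ for $g(p,\xi)\in C$: there exist $\kappa\ge0$ and neighborhoods $V$ of $\bar p$ in $P$, $U$ of $\bar\xi$ with $\operatorname{dist}(\xi;\Gamma(p))\le\kappa\operatorname{dist}(g(p,\xi);C)$ for $(p,\xi)\in V\times U$. Lipschitz-like: there exist $\ell\ge0$ and neighborhoods $V$ of $\bar p$ in $P$, $U$ of $(\bar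 x,\bar y)$ with $\Gamma(p)\cap U\subset\Gamma(p')+\ell\|p-p'\|\mathbb{B}$ for all $p,p'\in V$. *)

theory Defs
  imports "HOL-Analysis.Analysis"
begin

definition contingent_cone :: "'a::real_normed_vector set \<Rightarrow> 'a \<Rightarrow> 'a set" where
  "contingent_cone \<Omega> z = {w. \<exists>t wk. (\<forall>k. t k > 0) \<and> t \<longlonglongrightarrow> 0 \<and> wk \<longlonglongrightarrow> w
        \<and> (\<forall>k. z + t k *\<^sub>R wk k \<in> \<Omega>)}"

definition regular_normal_cone :: "'a::real_inner set \<Rightarrow> 'a \<Rightarrow> 'a set" where
  "regular_normal_cone \<Omega> z = {v. z \<in> \<Omega> \<and>
      (\<forall>\<epsilon>>0. \<exists>\<delta>>0. \<forall>z'\<in>\<Omega>. dist z' z < \<delta> \<longrightarrow> inner v (z' - z) \<le> \<epsilon> * norm (z' - z))}"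

definition dir_limiting_normal_cone :: "'a::real_inner set \<Rightarrow> 'a \<Rightarrow> 'a \<Rightarrow> 'a set" where
  "dir_limiting_normal_cone \<Omega> z w = {v. \<exists>t wk vk. (\<forall>k. t k > 0) \<and> t \<longlonglongrightarrow> 0 \<and>
      wk \<longlonglongrightarrow> w \<and> vk \<longlonglongrightarrow> v \<and>
      (\<forall>k. z + t k *\<^sub>R wk k \<in> \<Omega> \<and> vk k \<in> regular_normal_cone \<Omega> (z + t k *\<^sub>R wk k))}"

text \<open>Graph of the normal cone mapping of the nonpositive orthant.\<close>
definition gph_N_nonpos :: "((real^'l) \<times> (real^'l)) set" where
  "gph_N_nonpos = {(a, y). \<forall>i. a $ i \<le> 0 \<and> y $ i \<ge> 0 \<and> a $ i * y $ i = 0}"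

definition C1_map :: "('a::euclidean_space \<Rightarrow> 'b::euclidean_space) \<Rightarrow> bool" where
  "C1_map f \<longleftrightarrow> (\<exists>Df. (\<forall>z. (f has_derivative blinfun_apply (Df z)) (at z)) \<and> continuous_on UNIV Df)"

definition C2_map :: "('a::euclidean_space \<Rightarrow> 'b::euclidean_space) \<Rightarrow> bool" where
  "C2_map f \<longleftrightarrow> (\<exists>Df D2f. (\<forall>z. (f has_derivative blinfun_apply (Df z)) (at z)) \<and>
      (\<forall>z. (Df has_derivative blinfun_apply (D2f z)) (at z)) \<and> continuous_on UNIV D2f)"

definition grad_x :: "('p::real_normed_vector \<times> 'x::real_normed_vector \<Rightarrow> 'c::real_normed_vector)
    \<Rightarrow> 'p \<Rightarrow> 'x \<Rightarrow> 'x \<Rightarrow> 'c" where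
  "grad_x f p x = (\<lambda>u. frechet_derivative f (at (p, x)) (0, u))"

definition Gmap :: "((real^'m) \<times> (real^'n) \<Rightarrow> (real^'n)) \<Rightarrow> ((real^'m) \<times> (real^'n) \<Rightarrow> (real^'l))
    \<Rightarrow> (real^'m) \<times> ((real^'n) \<times> (real^'l)) \<Rightarrow> (real^'n)" where
  "Gmap F \<phi> = (\<lambda>(p, x, y). F (p, x) + adjoint (grad_x \<phi> p x) y)"

definition gmap :: "((real^'m) \<times> (real^'n) \<Rightarrow> (real^'n)) \<Rightarrow> ((real^'m) \<times> (real^'n) \<Rightarrow> (real^'l))
    \<Rightarrow> (real^'m) \<Rightarrow> (real^'n) \<times> (real^'l) \<Rightarrow> (real^'n) \<times> ((real^'l) \<times> (real^'l))" where
  "gmap F \<phi> p = (\<lambda>(x, y). (Gmap F \<phi> (p, x, y), (\<phi> (p, x), y)))"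

definition Cset :: "((real^'n) \<times> ((real^'l) \<times> (real^'l))) set" where
  "Cset = {0} \<times> gph_N_nonpos"

definition Gamma_map :: "((real^'m) \<times> (real^'n) \<Rightarrow> (real^'n)) \<Rightarrow> ((real^'m) \<times> (real^'n) \<Rightarrow> (real^'l))
    \<Rightarrow> (real^'m) \<Rightarrow> ((real^'n) \<times> (real^'l)) set" where
  "Gamma_map F \<phi> p = {xi. gmap F \<phi> p xi \<in> Cset}"

text \<open>Robinson stability of g(p,xi) in C, p in P, at (pb, xib).  Distance to the empty set
  is +infinity, so nonemptiness of Gamma(p) is made explicit (infdist x {} = 0 in Isabelle).\<close>
definition robinson_stable ::
  "('p::metric_space \<Rightarrow> 'x::metric_space \<Rightarrow> 'z::metric_space) \<Rightarrow> 'z set \<Rightarrow> 'p set \<Rightarrow> 'p \<Rightarrow> 'x \<Rightarrow> bool" where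
  "robinson_stable g C P pb xib \<longleftrightarrow>
     (\<exists>\<kappa>\<ge>0. \<exists>V U. open V \<and> pb \<in> V \<and> open U \<and> xib \<in> U \<and>
        (\<forall>p\<in>V \<inter> P. \<forall>xi\<in>U. {xi'. g p xi' \<in> C} \<noteq> {} \<and>
            infdist xi {xi'. g p xi' \<in> C} \<le> \<kappa> * infdist (g p xi) C))"

definition lipschitz_like :: "('p::metric_space \<Rightarrow> 'x::metric_space set) \<Rightarrow> 'p set \<Rightarrow> 'p \<Rightarrow> 'x \<Rightarrow> bool" where
  "lipschitz_like \<Gamma> P pb xib \<longleftrightarrow>
     (\<exists>L\<ge>0. \<exists>V U. open V \<and> pb \<in> V \<and> open U \<and> xib \<in> U \<and>
        (\<forall>p\<in>V \<inter> P. \<forall>p'\<in>V \<inter> P. \<forall>xi\<in>\<Gamma> p \<inter> U. \<exists>xi'\<in>\<Gamma> p'. dist xi xi' \<le> L * dist p p'))"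

end

theory Submission
  imports Defs
begin

text \<open>If the error bound failed along points \<open>(p\<^sub>k, x\<^sub>k)\<close> tending to the reference point,
  then \<open>x\<^sub>k\<close> would have a ball free of solutions whose radius is large compared with the residual
  \<open>\<delta>\<^sub>k = dist (g (p\<^sub>k, x\<^sub>k)) C\<close>. Minimizing the residual plus a small multiple of the distance to
  \<open>x\<^sub>k\<close> over such a ball (a finite-dimensional form of Ekeland's principle) yields unit regular
  normals to \<open>C\<close> that are almost annihilated by the adjoint of the partial derivative of \<open>g\<close> in \<open>x\<close>.
  If moreover \<open>\<delta>\<^sub>k\<close> is negligible compared with the distance to the reference point, the limit is
  a unit directional normal violating the second hypothesis.

  That \<open>\<delta>\<^sub>k\<close> is negligible follows once the reference solution is known to lie within
  \<open>O(dist p pb)\<close> of the solution set for \<open>p\<close>. This in turn follows from the same argument applied to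
  the points supplied by the first hypothesis, whose residual is of higher order because
  the complementarity set is polyhedral, so that each of its tangents is a feasible ray.\<close>

section \<open>Approximate normals at infeasible points\<close>

text \<open>Expanding \<open>norm (q - z)\<close> squared around \<open>y\<close> shows that
  nearest-point optimality bounds \<open>inner (q - y) (z - y)\<close> by the square of
  \<open>norm (z - y)\<close>. This quadratic bound is stronger than the first-order one in the
  definition of regular normals.\<close>

lemma proximal_normal_imp_regular_normal:
  fixes C :: "'a::real_inner set"
  assumes y: "y \<in> C" and s: "0 \<le> s" and nearest: "\<And>z. z \<in> C \<Longrightarrow> dist q y \<le> dist q z"
  shows "s *\<^sub>R (q - y) \<in> regular_normal_cone C y"
  unfolding regular_normal_cone_def
proof (intro CollectI conjI allI impI y)
  fix \<epsilon> :: real assume \<epsilon>: "\<epsilon> > 0"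
  show "\<exists>\<delta>>0. \<forall>z\<in>C. dist z y < \<delta> \<longrightarrow> inner (s *\<^sub>R (q - y)) (z - y) \<le> \<epsilon> * norm (z - y)"
  \<comment> \<open>The denominator \<open>s + 1\<close> also covers \<open>s = 0\<close>.\<close>
  proof (intro exI[of _ "\<epsilon> / (s + 1)"] conjI ballI impI)
    show "\<epsilon> / (s + 1) > 0" using \<epsilon> s by simp
    fix z assume z: "z \<in> C" and "dist z y < \<epsilon> / (s + 1)"
    hence d: "(s + 1) * norm (z - y) \<le> \<epsilon>" using s by (simp add: dist_norm field_simps)
    have "(norm (q - y))\<^sup>2 \<le> (norm (q - z))\<^sup>2"
      using nearest[OF z] by (simp add: dist_norm)
    also have "(norm (q - z))\<^sup>2 = (norm (q - y))\<^sup>2 - 2 * inner (q - y) (z - y) + (norm (z - y))\<^sup>2"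
      by (simp add: power2_norm_eq_inner inner_diff_left inner_diff_right inner_commute)
    finally have "2 * inner (q - y) (z - y) \<le> (norm (z - y))\<^sup>2" by simp
    hence "inner (q - y) (z - y) \<le> (norm (z - y))\<^sup>2" by (smt (verit) zero_le_power2)
    hence "s * inner (q - y) (z - y) \<le> s * (norm (z - y))\<^sup>2" using s by (rule mult_left_mono)
    also have "\<dots> \<le> (s + 1) * (norm (z - y))\<^sup>2" by (intro mult_right_mono) auto
    also have "\<dots> = ((s + 1) * norm (z - y)) * norm (z - y)" by (simp add: power2_eq_square)
    also have "\<dots> \<le> \<epsilon> * norm (z - y)" using d by (intro mult_right_mono) auto
    finally show "inner (s *\<^sub>R (q - y)) (z - y) \<le> \<epsilon> * norm (z - y)" by simp
  qed
qed

text \<open>A minimizer of the penalized residual lies in the open ball, so it can be perturbed in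
  every direction. The distance to \<open>C\<close> need not be differentiable there, but the
  distance to a fixed nearest point \<open>y\<close> is, since \<open>g x\<close> differs from
  \<open>y\<close>. Its gradient involves exactly the unit normal \<open>l\<close>.\<close>

lemma infeasible_ball_imp_small_adjoint:
  fixes g :: "'x::euclidean_space \<Rightarrow> 'z::euclidean_space"
  assumes C: "closed C" "C \<noteq> {}"
    and der: "\<And>x. (g has_derivative D x) (at x)"
    and r: "r > 0" and infeasible: "\<And>x. x \<in> cball x0 r \<Longrightarrow> g x \<notin> C"
  shows "\<exists>x y l. dist x x0 \<le> r \<and> dist (g x) y \<le> infdist (g x0) C \<and> y \<in> C \<and> norm l = 1
    \<and> l \<in> regular_normal_cone C y
    \<and> (\<forall>u. \<bar>inner l (D x u)\<bar> \<le> 2 * infdist (g x0) C / r * norm u)"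
proof -
  define \<delta> where "\<delta> = infdist (g x0) C"
  \<comment> \<open>The factor 2 places the minimizer within \<open>r / 2\<close> of
    \<open>x0\<close>: comparing \<open>h\<close> at \<open>x\<close> and at \<open>x0\<close> gives
    \<open>\<sigma> * dist x x0 \<le> \<delta>\<close>.\<close>
  define \<sigma> where "\<sigma> = 2 * \<delta> / r"
  define h where "h = (\<lambda>x. infdist (g x) C + \<sigma> * dist x x0)"
  have "x0 \<in> cball x0 r" using r by simp
  hence \<delta>0: "\<delta> > 0"
    using infeasible C unfolding \<delta>_def by (metis in_closed_iff_infdist_zero infdist_nonneg less_eq_real_def)
  hence \<sigma>0: "\<sigma> > 0" using r by (simp add: \<sigma>_def)
  have gc: "continuous_on UNIV g"
    using der has_derivative_continuous by (metis continuous_at_imp_continuous_on)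
  have "continuous_on (cball x0 r) h"
    unfolding h_def by (intro continuous_intros continuous_on_subset[OF gc]) auto
  then obtain x where x: "x \<in> cball x0 r" and xmin: "\<And>x'. x' \<in> cball x0 r \<Longrightarrow> h x \<le> h x'"
    using continuous_attains_inf[of "cball x0 r" h] r by auto
  have "h x \<le> h x0" using r by (intro xmin) auto
  hence hx: "infdist (g x) C + \<sigma> * dist x x0 \<le> \<delta>" by (simp add: h_def \<delta>_def)
  hence "\<sigma> * dist x x0 \<le> \<delta>" using infdist_nonneg[of "g x" C] by linarith
  hence "dist x x0 \<le> r / 2" using \<delta>0 r by (simp add: \<sigma>_def field_simps)
  hence xr: "dist x x0 < r" using r by linarith
  have "infdist (g x) C \<le> \<delta>" using hx \<sigma>0 by (smt (verit) mult_nonneg_nonneg zero_le_dist)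
  moreover obtain y where y: "y \<in> C" "infdist (g x) C = dist (g x) y"
    using infdist_attains_inf[OF C] by blast
  ultimately have gy: "dist (g x) y \<le> \<delta>" by simp
  have ne: "g x - y \<noteq> 0" using infeasible[OF x] y by auto
  define l where "l = (1 / norm (g x - y)) *\<^sub>R (g x - y)"
  have l1: "norm l = 1" using ne by (simp add: l_def)
  have lN: "l \<in> regular_normal_cone C y"
    unfolding l_def
    by (rule proximal_normal_imp_regular_normal) (use y infdist_le[of _ C "g x"] in auto)
  \<comment> \<open>With \<open>y\<close> frozen, \<open>norm (g x' - y)\<close> majorizes the
    residual and agrees with it at \<open>x\<close>, so minimality of \<open>h\<close> passes to
    this smooth function. Quotients with \<open>t > 0\<close> give a lower bound only; the bound for
    \<open>- u\<close> supplies the upper one afterwards.\<close>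
  have low: "- \<sigma> * norm u \<le> inner l (D x u)" for u
  proof -
    have dn: "((\<lambda>x'. norm (g x' - y)) has_derivative (\<lambda>u. inner l (D x u))) (at x)"
    proof -
      have "((\<lambda>x'. g x' - y) has_derivative D x) (at x)"
        by (auto intro!: derivative_eq_intros der)
      from has_derivative_compose[OF this has_derivative_norm[OF ne]]
      show ?thesis by (simp add: l_def sgn_div_norm inverse_eq_divide)
        (simp add: inner_commute)
    qed
    have path: "((\<lambda>t::real. x + t *\<^sub>R u) has_derivative (\<lambda>t. t *\<^sub>R u)) (at 0)"
      by (auto intro!: derivative_eq_intros)
    have "((\<lambda>t::real. norm (g (x + t *\<^sub>R u) - y)) has_derivative (\<lambda>t. inner l (D x (t *\<^sub>R u)))) (at 0)"
      using has_derivative_compose[OF path, of "\<lambda>x'. norm (g x' - y)"] dn by simp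
    moreover have "(\<lambda>t. inner l (D x (t *\<^sub>R u))) = (\<lambda>t. inner l (D x u) * t)"
      using has_derivative_linear[OF der[of x]] by (simp add: linear_scale mult.commute)
    ultimately have "((\<lambda>t::real. norm (g (x + t *\<^sub>R u) - y)) has_field_derivative inner l (D x u)) (at 0)"
      by (simp add: has_field_derivative_def)
    hence "((\<lambda>t. (norm (g (x + t *\<^sub>R u) - y) - norm (g x - y)) / t) \<longlongrightarrow> inner l (D x u)) (at 0)"
      by (simp add: has_field_derivative_iff)
    hence lim: "((\<lambda>t. (norm (g (x + t *\<^sub>R u) - y) - norm (g x - y)) / t) \<longlongrightarrow> inner l (D x u)) (at_right 0)"
      by (simp add: filterlim_at_split)
    have "((\<lambda>t::real. dist (x + t *\<^sub>R u) x0) \<longlongrightarrow> dist (x + 0 *\<^sub>R u) x0) (at_right 0)"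
      by (intro tendsto_intros)
    hence "\<forall>\<^sub>F t::real in at_right 0. dist (x + t *\<^sub>R u) x0 < r"
      using xr by (auto dest: order_tendstoD(2))
    moreover have "\<forall>\<^sub>F t::real in at_right 0. t > 0"
      by (simp add: eventually_at_right_less)
    ultimately have "\<forall>\<^sub>F t::real in at_right 0.
        - \<sigma> * norm u \<le> (norm (g (x + t *\<^sub>R u) - y) - norm (g x - y)) / t"
    proof eventually_elim
      case (elim t)
      have "infdist (g x) C + \<sigma> * dist x x0 \<le> infdist (g (x + t *\<^sub>R u)) C + \<sigma> * dist (x + t *\<^sub>R u) x0"
        using xmin[of "x + t *\<^sub>R u"] elim by (simp add: h_def dist_commute)
      moreover have "infdist (g (x + t *\<^sub>R u)) C \<le> norm (g (x + t *\<^sub>R u) - y)"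
        using infdist_le[OF y(1)] by (simp add: dist_norm)
      moreover have "dist (x + t *\<^sub>R u) x0 \<le> t * norm u + dist x x0"
        using dist_triangle[of "x + t *\<^sub>R u" x0 x] elim by (simp add: dist_norm)
      hence "\<sigma> * dist (x + t *\<^sub>R u) x0 \<le> \<sigma> * (t * norm u + dist x x0)"
        using \<sigma>0 by (intro mult_left_mono) auto
      ultimately have "- (\<sigma> * (t * norm u)) \<le> norm (g (x + t *\<^sub>R u) - y) - norm (g x - y)"
        using y(2) by (simp add: dist_norm algebra_simps)
      thus ?case using elim by (simp add: field_simps)
    qed
    thus ?thesis by (intro tendsto_lowerbound[OF lim]) auto
  qed
  have "\<bar>inner l (D x u)\<bar> \<le> \<sigma> * norm u" for u
    using low[of u] low[of "- u"] has_derivative_linear[OF der[of x]] by (simp add: linear_neg)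
  thus ?thesis
    using xr gy y(1) l1 lN unfolding \<sigma>_def \<delta>_def by (intro exI[of _ x] exI[of _ y] exI[of _ l]) auto
qed

section \<open>Error bounds for smooth parametric constraint systems\<close>

text \<open>The increments \<open>z k - a\<close> need only be asymptotic to
  \<open>t k *\<^sub>R w\<close>, so the direction may vary with \<open>k\<close>. This is the form
  in which difference quotients of feasible or nearly feasible points are linearized.\<close>

lemma has_derivative_sequentially:
  fixes f :: "'a::real_normed_vector \<Rightarrow> 'b::real_normed_vector"
  assumes f: "(f has_derivative D) (at a)"
    and t: "\<And>k. t k > 0" "t \<longlonglongrightarrow> 0"
    and w: "(\<lambda>k. (z k - a) /\<^sub>R t k) \<longlonglongrightarrow> w"
  shows "(\<lambda>k. (f (z k) - f a) /\<^sub>R t k) \<longlonglongrightarrow> D w"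
proof -
  obtain e where e: "\<And>h. f (a + h) = f a + D h + e h"
    and e0: "((\<lambda>h. norm (e h) / norm h) \<longlongrightarrow> 0) (at 0)"
    and D: "bounded_linear D"
    using f unfolding has_derivative_iff_Ex by blast
  define q where "q = (\<lambda>h. norm (e h) / norm h)"
  \<comment> \<open>Division by zero makes \<open>q 0 = 0\<close>, so the limit at 0 is continuity
    of \<open>q\<close>. Indices with \<open>z k = a\<close> are thereby covered as well.\<close>
  have "isCont q 0" using e0 by (simp add: q_def isCont_def)
  moreover have "(\<lambda>k. z k - a) \<longlonglongrightarrow> 0"
  proof -
    have "(\<lambda>k. t k *\<^sub>R ((z k - a) /\<^sub>R t k)) \<longlonglongrightarrow> 0 *\<^sub>R w" by (intro tendsto_intros t w)
    thus ?thesis using t(1) by (simp add: less_imp_neq[symmetric])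
  qed
  ultimately have q: "(\<lambda>k. q (z k - a)) \<longlonglongrightarrow> q 0" by (rule isCont_tendsto_compose)
  have "(\<lambda>k. q (z k - a) * norm ((z k - a) /\<^sub>R t k)) \<longlonglongrightarrow> q 0 * norm w"
    by (intro tendsto_intros q w)
  hence lim: "(\<lambda>k. q (z k - a) * norm ((z k - a) /\<^sub>R t k)) \<longlonglongrightarrow> 0" by (simp add: q_def)
  have e00: "e 0 = 0" using e[of 0] D by (simp add: linear_simps)
  have "(\<lambda>k. e (z k - a) /\<^sub>R t k) \<longlonglongrightarrow> 0"
  proof (rule tendsto_norm_zero_cancel, rule Lim_transform_eventually[OF lim], rule always_eventually, rule allI)
    fix k show "q (z k - a) * norm ((z k - a) /\<^sub>R t k) = norm (e (z k - a) /\<^sub>R t k)"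
      using t(1)[of k] e00 by (cases "z k = a") (auto simp: q_def divide_simps)
  qed
  moreover have "(\<lambda>k. D ((z k - a) /\<^sub>R t k)) \<longlonglongrightarrow> D w"
    by (rule bounded_linear.tendsto[OF D w])
  ultimately have "(\<lambda>k. D ((z k - a) /\<^sub>R t k) + e (z k - a) /\<^sub>R t k) \<longlonglongrightarrow> D w + 0"
    by (intro tendsto_add)
  moreover have "D ((z k - a) /\<^sub>R t k) + e (z k - a) /\<^sub>R t k = (f (z k) - f a) /\<^sub>R t k" for k
  proof -
    have "f (z k) - f a = D (z k - a) + e (z k - a)" using e[of "z k - a"] by (simp add: algebra_simps)
    thus ?thesis using linear_scale[OF bounded_linear.linear[OF D]] by (simp add: scaleR_add_right)
  qed
  ultimately show ?thesis by simp
qed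

lemma tendsto_scaled_difference_imp_tendsto:
  fixes z :: "nat \<Rightarrow> 'a::real_normed_vector"
  assumes t: "\<And>k. t k > 0" "t \<longlonglongrightarrow> 0" and w: "(\<lambda>k. (z k - a) /\<^sub>R t k) \<longlonglongrightarrow> w"
  shows "z \<longlonglongrightarrow> a"
proof -
  have "(\<lambda>k. a + t k *\<^sub>R ((z k - a) /\<^sub>R t k)) \<longlonglongrightarrow> a + 0 *\<^sub>R w"
    by (intro tendsto_intros t w)
  thus ?thesis using t(1) by (simp add: less_imp_neq[symmetric])
qed

lemma contingent_coneI:
  assumes t: "\<And>k. t k > 0" "t \<longlonglongrightarrow> 0" and w: "(\<lambda>k. (z k - a) /\<^sub>R t k) \<longlonglongrightarrow> w"
    and z: "\<And>k. z k \<in> \<Omega>"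
  shows "w \<in> contingent_cone \<Omega> a"
  unfolding contingent_cone_def
  using t w z less_imp_neq[OF t(1), symmetric]
  by (intro CollectI exI[of _ t] exI[of _ "\<lambda>k. (z k - a) /\<^sub>R t k"]) simp

lemma unit_sequence_convergent_subsequence:
  fixes f :: "nat \<Rightarrow> 'a::euclidean_space"
  assumes "\<And>k. norm (f k) = 1"
  obtains l s where "norm l = 1" "strict_mono s" "(\<lambda>k. f (s k)) \<longlonglongrightarrow> l"
proof -
  have "seq_compact (sphere (0::'a) 1)" by (simp add: compact_imp_seq_compact)
  moreover have "\<forall>k. f k \<in> sphere 0 1" using assms by simp
  ultimately obtain l s where "l \<in> sphere 0 1" "strict_mono s" "(f \<circ> s) \<longlonglongrightarrow> l"
    by (rule seq_compactE)
  thus ?thesis using that by (simp add: comp_def)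
qed

section \<open>Constraint systems under directional first-order conditions\<close>

text \<open>\<open>linearized_solvable\<close> asks for a whole short ray in \<open>C\<close>, not
  just a tangent vector. The scales at which it is used are dictated by a given sequence of
  parameters, whereas a contingent tangent is approximated from \<open>C\<close> only along some
  sequence of scales of its own.\<close>

locale C1_constraint_system =
  fixes g :: "'p::euclidean_space \<times> 'x::euclidean_space \<Rightarrow> 'z::euclidean_space"
    and D :: "'p \<times> 'x \<Rightarrow> 'p \<times> 'x \<Rightarrow> 'z"
    and C :: "'z set" and P :: "'p set" and pb :: 'p and xb :: 'x
  assumes closed_C: "closed C"
    and has_der: "\<And>z. (g has_derivative D z) (at z)"
    and cont_der: "\<And>h. continuous_on UNIV (\<lambda>z. D z h)"
    and feasible: "g (pb, xb) \<in> C"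
    and linearized_solvable: "\<And>w. w \<in> contingent_cone P pb \<Longrightarrow>
      \<exists>u. \<forall>\<^sub>F t in at_right 0. g (pb, xb) + t *\<^sub>R D (pb, xb) (w, u) \<in> C"
    and directional_qualification: "\<And>w u l. \<lbrakk>(w, u) \<noteq> (0, 0); w \<in> contingent_cone P pb;
      D (pb, xb) (w, u) \<in> contingent_cone C (g (pb, xb));
      l \<in> dir_limiting_normal_cone C (g (pb, xb)) (D (pb, xb) (w, u));
      \<And>u'. inner l (D (pb, xb) (0, u')) = 0\<rbrakk> \<Longrightarrow> l = 0"
begin

abbreviation "\<Gamma> p \<equiv> {x. g (p, x) \<in> C}"

lemma C_nonempty: "C \<noteq> {}" using feasible by blast

lemma cont_g: "continuous_on UNIV g"
  using has_der has_derivative_continuous by (metis continuous_at_imp_continuous_on)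

lemma closed_\<Gamma>: "closed (\<Gamma> p)"
proof -
  have "closed ((\<lambda>x. g (p, x)) -` C)"
    by (rule closed_vimage[OF closed_C])
       (intro continuous_on_compose2[OF cont_g] continuous_intros, auto)
  thus ?thesis by (simp add: vimage_def)
qed

lemma partial_has_derivative: "((\<lambda>x. g (p, x)) has_derivative (\<lambda>u. D (p, x) (0, u))) (at x)"
  by (rule has_derivative_compose[OF _ has_der]) (auto intro!: derivative_eq_intros)

text \<open>The radii are shrunk to at most the geometric mean of the residual and the scale
  \<^term>\<open>t k\<close>: they then stay large compared with the residual, which forces the adjoint images of
  the normals to vanish, and small compared with the scale, which preserves the tangent
  direction.\<close>

lemma no_infeasible_tangential_sequence:
  assumes P: "\<And>k. p k \<in> P" and t: "\<And>k. t k > 0" "t \<longlonglongrightarrow> 0"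
    and w: "(\<lambda>k. (p k - pb) /\<^sub>R t k) \<longlonglongrightarrow> w" and u: "(\<lambda>k. (x k - xb) /\<^sub>R t k) \<longlonglongrightarrow> u"
    and wu: "(w, u) \<noteq> (0, 0)"
    and R: "\<And>k. R k > 0"
    and \<delta>t: "(\<lambda>k. infdist (g (p k, x k)) C / t k) \<longlonglongrightarrow> 0"
    and \<delta>R: "(\<lambda>k. infdist (g (p k, x k)) C / R k) \<longlonglongrightarrow> 0"
    and infeasible: "\<And>k x'. x' \<in> cball (x k) (R k) \<Longrightarrow> g (p k, x') \<notin> C"
  shows False
proof -
  define \<delta> where "\<delta> k = infdist (g (p k, x k)) C" for k
  define r where "r k = min (R k) (sqrt (\<delta> k * t k))" for k
  have \<delta>0: "\<delta> k > 0" for k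
  proof -
    have "g (p k, x k) \<notin> C" using R[of k] by (intro infeasible) auto
    thus ?thesis unfolding \<delta>_def
      by (metis closed_C C_nonempty in_closed_iff_infdist_zero infdist_nonneg less_eq_real_def)
  qed
  have r0: "r k > 0" for k using R \<delta>0 t by (simp add: r_def)
  have sq: "(\<lambda>k. sqrt (\<delta> k / t k)) \<longlonglongrightarrow> 0"
    using tendsto_real_sqrt[OF \<delta>t] by (simp add: \<delta>_def)
  have rt: "(\<lambda>k. r k / t k) \<longlonglongrightarrow> 0"
  proof (rule real_tendsto_sandwich[OF always_eventually always_eventually tendsto_const sq]; intro allI)
    fix k
    show "0 \<le> r k / t k" using r0[of k] t(1)[of k] by simp
    have "r k / t k \<le> sqrt (\<delta> k * t k) / t k"
      using t(1)[of k] by (intro divide_right_mono) (auto simp: r_def)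
    also have "\<dots> = sqrt (\<delta> k / t k)"
      using t(1)[of k] by (simp add: real_sqrt_mult real_sqrt_divide field_simps)
    finally show "r k / t k \<le> sqrt (\<delta> k / t k)" .
  qed
  have \<delta>r: "(\<lambda>k. \<delta> k / r k) \<longlonglongrightarrow> 0"
  proof (rule real_tendsto_sandwich[where f = "\<lambda>_. 0"])
    show "(\<lambda>k. \<delta> k / R k + sqrt (\<delta> k / t k)) \<longlonglongrightarrow> 0"
      using tendsto_add[OF \<delta>R sq] by (simp add: \<delta>_def)
    show "\<forall>\<^sub>F k in sequentially. 0 \<le> \<delta> k / r k" using \<delta>0 r0 by (simp add: less_imp_le)
    show "\<forall>\<^sub>F k in sequentially. \<delta> k / r k \<le> \<delta> k / R k + sqrt (\<delta> k / t k)"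
    proof (intro always_eventually allI)
      fix k
      \<comment> \<open>\<open>\<delta> k / r k\<close> is the larger of the quotients belonging to
        the two arguments of the minimum, hence at most their sum.\<close>
      have "\<delta> k / sqrt (\<delta> k * t k) = sqrt (\<delta> k / t k)"
        using \<delta>0[of k] t(1)[of k] by (simp add: real_sqrt_mult real_sqrt_divide real_div_sqrt field_simps)
      moreover have "\<delta> k / R k \<ge> 0" "sqrt (\<delta> k / t k) \<ge> 0" using \<delta>0[of k] t(1)[of k] R[of k] by auto
      ultimately show "\<delta> k / r k \<le> \<delta> k / R k + sqrt (\<delta> k / t k)"
        unfolding r_def min_def by (simp del: real_sqrt_ge_0_iff)
    qed
  qed simp
  have "\<exists>x' y l. dist x' (x k) \<le> r k \<and> dist (g (p k, x')) y \<le> \<delta> k \<and> y \<in> C \<and> norm l = 1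
      \<and> l \<in> regular_normal_cone C y \<and> (\<forall>u. \<bar>inner l (D (p k, x') (0, u))\<bar> \<le> 2 * \<delta> k / r k * norm u)" for k
    unfolding \<delta>_def
    by (rule infeasible_ball_imp_small_adjoint[OF closed_C C_nonempty partial_has_derivative])
       (use r0 infeasible in \<open>auto simp: r_def\<close>)
  then obtain x' y l where x': "\<And>k. dist (x' k) (x k) \<le> r k"
    and gy: "\<And>k. dist (g (p k, x' k)) (y k) \<le> \<delta> k" and y: "\<And>k. y k \<in> C"
    and l1: "\<And>k. norm (l k) = 1" and lN: "\<And>k. l k \<in> regular_normal_cone C (y k)"
    and adj: "\<And>k u. \<bar>inner (l k) (D (p k, x' k) (0, u))\<bar> \<le> 2 * \<delta> k / r k * norm u"
    by metis
  have "(\<lambda>k. (x' k - x k) /\<^sub>R t k) \<longlonglongrightarrow> 0"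
  proof (rule Lim_null_comparison[OF _ rt], intro always_eventually allI)
    fix k show "norm ((x' k - x k) /\<^sub>R t k) \<le> r k / t k"
      using x'[of k] t(1)[of k] by (simp add: dist_norm divide_simps)
  qed
  from tendsto_add[OF this u] have u': "(\<lambda>k. (x' k - xb) /\<^sub>R t k) \<longlonglongrightarrow> u"
    by (simp add: algebra_simps)
  have z: "(\<lambda>k. ((p k, x' k) - (pb, xb)) /\<^sub>R t k) \<longlonglongrightarrow> (w, u)"
    using tendsto_Pair[OF w u'] by simp
  have zlim: "(\<lambda>k. (p k, x' k)) \<longlonglongrightarrow> (pb, xb)"
    by (rule tendsto_scaled_difference_imp_tendsto[OF t z])
  \<comment> \<open>The points \<open>y k\<close> of \<open>C\<close> stay within the residual of
    \<open>g (p k, x' k)\<close>, which is negligible at scale \<open>t k\<close>. So they approach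
    \<open>g (pb, xb)\<close> in the direction given by the derivative, and they serve both as
    witnesses of tangency and as base points of the directional normal.\<close>
  have "(\<lambda>k. (y k - g (p k, x' k)) /\<^sub>R t k) \<longlonglongrightarrow> 0"
  proof (rule Lim_null_comparison[OF _ \<delta>t], intro always_eventually allI)
    fix k show "norm ((y k - g (p k, x' k)) /\<^sub>R t k) \<le> infdist (g (p k, x k)) C / t k"
      using gy[of k] t(1)[of k] by (simp add: dist_norm divide_simps \<delta>_def norm_minus_commute)
  qed
  from tendsto_add[OF this has_derivative_sequentially[OF has_der t z]]
  have ylim: "(\<lambda>k. (y k - g (pb, xb)) /\<^sub>R t k) \<longlonglongrightarrow> D (pb, xb) (w, u)"
    by (simp add: algebra_simps)
  obtain lam s where s: "strict_mono s" and lam: "(\<lambda>k. l (s k)) \<longlonglongrightarrow> lam" "norm lam = 1"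
    using unit_sequence_convergent_subsequence[of l] l1 by metis
  have w_tan: "w \<in> contingent_cone P pb" by (rule contingent_coneI[OF t w P])
  have tan: "D (pb, xb) (w, u) \<in> contingent_cone C (g (pb, xb))"
    by (rule contingent_coneI[OF t ylim y])
  have normal: "lam \<in> dir_limiting_normal_cone C (g (pb, xb)) (D (pb, xb) (w, u))"
    unfolding dir_limiting_normal_cone_def
  proof (intro CollectI exI conjI allI)
    let ?w = "\<lambda>k. (y (s k) - g (pb, xb)) /\<^sub>R t (s k)"
    show "(t \<circ> s) k > 0" for k using t by simp
    show "(t \<circ> s) \<longlonglongrightarrow> 0" by (rule LIMSEQ_subseq_LIMSEQ[OF t(2) s])
    show "?w \<longlonglongrightarrow> D (pb, xb) (w, u)"
      using LIMSEQ_subseq_LIMSEQ[OF ylim s] by (simp add: comp_def)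
    show "(\<lambda>k. l (s k)) \<longlonglongrightarrow> lam" by (rule lam)
    fix k
    have eq: "g (pb, xb) + (t \<circ> s) k *\<^sub>R ?w k = y (s k)"
      using t(1)[of "s k"] by simp
    show "g (pb, xb) + (t \<circ> s) k *\<^sub>R ?w k \<in> C" unfolding eq by (rule y)
    show "l (s k) \<in> regular_normal_cone C (g (pb, xb) + (t \<circ> s) k *\<^sub>R ?w k)"
      unfolding eq using lN by simp
  qed
  have "inner lam (D (pb, xb) (0, v)) = 0" for v
  proof -
    have "isCont (\<lambda>z. D z (0, v)) (pb, xb)"
      using cont_der by (simp add: continuous_on_eq_continuous_at)
    from LIMSEQ_subseq_LIMSEQ[OF isCont_tendsto_compose[OF this zlim] s]
    have "(\<lambda>k. D (p (s k), x' (s k)) (0, v)) \<longlonglongrightarrow> D (pb, xb) (0, v)" by (simp add: comp_def)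
    from tendsto_inner[OF lam(1) this]
    have "(\<lambda>k. inner (l (s k)) (D (p (s k), x' (s k)) (0, v))) \<longlonglongrightarrow> inner lam (D (pb, xb) (0, v))"
      by (simp add: comp_def)
    \<comment> \<open>The same inner products are bounded by \<open>2 * \<delta> / r\<close> times
      \<open>norm v\<close>, so their limit, identified above through continuity of the derivative,
      must vanish.\<close>
    moreover have "(\<lambda>k. inner (l (s k)) (D (p (s k), x' (s k)) (0, v))) \<longlonglongrightarrow> 0"
    proof (rule Lim_null_comparison)
      have "(\<lambda>k. 2 * (\<delta> k / r k) * norm v) \<longlonglongrightarrow> 2 * 0 * norm v" by (intro tendsto_intros \<delta>r)
      from LIMSEQ_subseq_LIMSEQ[OF this s]
      show "(\<lambda>k. 2 * \<delta> (s k) / r (s k) * norm v) \<longlonglongrightarrow> 0" by (simp add: comp_def)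
    qed (use adj in simp)
    ultimately show ?thesis by (rule LIMSEQ_unique)
  qed
  with directional_qualification[OF wu w_tan tan normal] lam(2) show False by simp
qed


text \<open>If no linear rate held, normalizing \<open>p k - pb\<close> would produce a tangent
  \<open>w\<close> to \<open>P\<close>. The points \<open>xb + t k *\<^sub>R u\<close>, with
  \<open>u\<close> solving the linearized system for \<open>w\<close>, have residual of smaller
  order than \<open>t k\<close>. The balls of radius \<open>t k\<close> around them reach only
  \<open>(norm u + 1) * t k\<close> away from \<open>xb\<close>, so they eventually contain no
  solution.\<close>

lemma linear_rate_feasible_points:
  "\<exists>c\<ge>0. \<exists>e>0. \<forall>p\<in>P \<inter> ball pb e. \<exists>x\<in>\<Gamma> p. dist xb x \<le> c * dist pb p"
proof (rule ccontr)
  assume contra: "\<not> ?thesis"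
  have "\<exists>p\<in>P \<inter> ball pb (1 / real (Suc k)). \<forall>x\<in>\<Gamma> p. real k * dist pb p < dist xb x" for k
  proof (rule ccontr)
    assume "\<not> ?thesis"
    hence "\<forall>p\<in>P \<inter> ball pb (1 / real (Suc k)). \<exists>x\<in>\<Gamma> p. dist xb x \<le> real k * dist pb p"
      by (metis linorder_not_less)
    moreover have "(0::real) \<le> real k" "0 < 1 / real (Suc k)" by auto
    ultimately show False using contra by blast
  qed
  then obtain p where p: "\<And>k. p k \<in> P" "\<And>k. dist pb (p k) < 1 / real (Suc k)"
    and far: "\<And>k x. x \<in> \<Gamma> (p k) \<Longrightarrow> real k * dist pb (p k) < dist xb x"
    by (metis IntE mem_ball)
  \<comment> \<open>For \<open>p k = pb\<close> the solution \<open>xb\<close> itself would satisfy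
    \<open>0 < 0\<close>.\<close>
  have p_ne: "p k \<noteq> pb" for k using far[of xb k] feasible by auto
  have p_lim: "(\<lambda>k. dist pb (p k)) \<longlonglongrightarrow> 0"
    by (rule real_tendsto_sandwich[OF _ _ tendsto_const LIMSEQ_Suc[OF lim_1_over_n]])
       (use p(2) in \<open>auto intro: always_eventually less_imp_le\<close>)
  have "norm ((p k - pb) /\<^sub>R dist pb (p k)) = 1" for k
    using p_ne[of k] by (simp add: dist_norm norm_minus_commute)
  then obtain w s where w1: "norm w = 1" and s: "strict_mono s"
    and w: "(\<lambda>k. (p (s k) - pb) /\<^sub>R dist pb (p (s k))) \<longlonglongrightarrow> w"
    by (rule unit_sequence_convergent_subsequence)
  define t where "t k = dist pb (p (s k))" for k
  have t: "t k > 0" for k using p_ne[of "s k"] by (auto simp: t_def)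
  have t0: "t \<longlonglongrightarrow> 0" using LIMSEQ_subseq_LIMSEQ[OF p_lim s] by (simp add: t_def[abs_def] comp_def)
  have wt: "(\<lambda>k. (p (s k) - pb) /\<^sub>R t k) \<longlonglongrightarrow> w" using w by (simp add: t_def)
  have "w \<in> contingent_cone P pb" by (rule contingent_coneI[OF t t0 wt p(1)])
  from linearized_solvable[OF this] obtain u
    where u: "\<forall>\<^sub>F t in at_right 0. g (pb, xb) + t *\<^sub>R D (pb, xb) (w, u) \<in> C" by blast
  define x where "x k = xb + t k *\<^sub>R u" for k
  have ut: "(\<lambda>k. (x k - xb) /\<^sub>R t k) \<longlonglongrightarrow> u"
    using t by (simp add: x_def less_imp_neq[symmetric])
  have z: "(\<lambda>k. ((p (s k), x k) - (pb, xb)) /\<^sub>R t k) \<longlonglongrightarrow> (w, u)"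
    using tendsto_Pair[OF wt ut] by simp
  have "filterlim t (at_right 0) sequentially"
    using t0 t by (intro tendsto_imp_filterlim_at_right) auto
  hence ev1: "\<forall>\<^sub>F k in sequentially. g (pb, xb) + t k *\<^sub>R D (pb, xb) (w, u) \<in> C"
    by (rule eventually_compose_filterlim[OF u])
  have \<delta>: "(\<lambda>k. infdist (g (p (s k), x k)) C / t k) \<longlonglongrightarrow> 0"
  proof (rule real_tendsto_sandwich[where f = "\<lambda>_. 0"])
    have "(\<lambda>k. norm ((g (p (s k), x k) - g (pb, xb)) /\<^sub>R t k - D (pb, xb) (w, u)))
        \<longlonglongrightarrow> norm (D (pb, xb) (w, u) - D (pb, xb) (w, u))"
      by (intro tendsto_intros has_derivative_sequentially[OF has_der t t0 z])
    thus "(\<lambda>k. norm ((g (p (s k), x k) - g (pb, xb)) /\<^sub>R t k - D (pb, xb) (w, u))) \<longlonglongrightarrow> 0" by simp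
    show "\<forall>\<^sub>F k in sequentially. infdist (g (p (s k), x k)) C / t k
        \<le> norm ((g (p (s k), x k) - g (pb, xb)) /\<^sub>R t k - D (pb, xb) (w, u))"
      using ev1
    proof eventually_elim
      case (elim k)
      have "infdist (g (p (s k), x k)) C
          \<le> norm (g (p (s k), x k) - (g (pb, xb) + t k *\<^sub>R D (pb, xb) (w, u)))"
        using infdist_le[OF elim] by (simp add: dist_norm)
      also have "g (p (s k), x k) - (g (pb, xb) + t k *\<^sub>R D (pb, xb) (w, u))
          = t k *\<^sub>R ((g (p (s k), x k) - g (pb, xb)) /\<^sub>R t k - D (pb, xb) (w, u))"
        using t[of k] by (simp add: algebra_simps)
      finally show ?case using t[of k] by (simp add: divide_simps mult.commute)
    qed
  qed (use t in \<open>auto intro!: always_eventually divide_nonneg_pos infdist_nonneg\<close>)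
  \<comment> \<open>Dropping the first \<open>N\<close> terms makes \<open>s (k + N)\<close> at
    least \<open>norm u + 1\<close>, as required by the comparison of radii.\<close>
  obtain N where N: "norm u + 1 \<le> real N" using real_arch_simple by blast
  show False
  \<comment> \<open>The ball radius is taken equal to the scale \<open>t\<close>, which is why one
    positivity goal and one limit occur twice.\<close>
  proof (rule no_infeasible_tangential_sequence)
    show "p (s (k + N)) \<in> P" for k by (rule p)
    show "t (k + N) > 0" for k by (rule t)
    show "t (k + N) > 0" for k by (rule t)
    show "(\<lambda>k. t (k + N)) \<longlonglongrightarrow> 0" using t0 by (rule LIMSEQ_ignore_initial_segment)
    show "(\<lambda>k. (p (s (k + N)) - pb) /\<^sub>R t (k + N)) \<longlonglongrightarrow> w"
      using LIMSEQ_ignore_initial_segment[OF wt, of N] by simp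
    show "(\<lambda>k. (x (k + N) - xb) /\<^sub>R t (k + N)) \<longlonglongrightarrow> u"
      using LIMSEQ_ignore_initial_segment[OF ut, of N] by simp
    show "(\<lambda>k. infdist (g (p (s (k + N)), x (k + N))) C / t (k + N)) \<longlonglongrightarrow> 0"
      using LIMSEQ_ignore_initial_segment[OF \<delta>, of N] by simp
    thus "(\<lambda>k. infdist (g (p (s (k + N)), x (k + N))) C / t (k + N)) \<longlonglongrightarrow> 0" .
    show "(w, u) \<noteq> (0, 0)" using w1 by auto
    fix k x' assume x': "x' \<in> cball (x (k + N)) (t (k + N))"
    show "g (p (s (k + N)), x') \<notin> C"
    proof
      assume "g (p (s (k + N)), x') \<in> C"
      hence "real (s (k + N)) * t (k + N) < dist xb x'" using far by (simp add: t_def)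
      also have "\<dots> \<le> dist xb (x (k + N)) + dist (x (k + N)) x'" by (rule dist_triangle)
      also have "\<dots> \<le> t (k + N) * norm u + t (k + N)"
        using x' t[of "k + N"] by (simp add: x_def dist_norm)
      also have "\<dots> = (norm u + 1) * t (k + N)" by (simp add: algebra_simps)
      also have "\<dots> \<le> real (s (k + N)) * t (k + N)"
        using N seq_suble[OF s, of "k + N"] t[of "k + N"] by (intro mult_right_mono) auto
      finally show False by simp
    qed
  qed
qed

text \<open>Violation with constant \<open>Suc k\<close> makes the ball of radius
  \<open>R k\<close>, which is \<open>Suc k\<close> times the residual, free of solutions. The
  linear rate bounds the distance from \<open>x k\<close> to the solution set by
  \<open>(1 + c) * t k\<close>, so the residual is at most \<open>(1 + c) / Suc k\<close> times
  \<open>t k\<close>. Both ratios required for the contradiction therefore tend to zero.\<close>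

lemma uniform_error_bound:
  "\<exists>\<kappa>\<ge>0. \<exists>e>0. \<forall>p\<in>P \<inter> ball pb e. \<forall>x\<in>ball xb e.
     \<Gamma> p \<noteq> {} \<and> infdist x (\<Gamma> p) \<le> \<kappa> * infdist (g (p, x)) C"
proof (rule ccontr)
  assume contra: "\<not> ?thesis"
  obtain c e where c: "c \<ge> 0" and e: "e > 0"
    and near: "\<And>p. p \<in> P \<inter> ball pb e \<Longrightarrow> \<exists>x\<in>\<Gamma> p. dist xb x \<le> c * dist pb p"
    using linear_rate_feasible_points by blast
  \<comment> \<open>The cap \<open>e\<close> keeps the parameters where solutions are already known
    to exist, so a violation can only concern the distance estimate.\<close>
  define d where "d k = min e (1 / real (Suc k))" for k
  have d0: "d k > 0" for k using e by (simp add: d_def)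
  have "\<exists>p\<in>P \<inter> ball pb (d k). \<exists>x\<in>ball xb (d k). real (Suc k) * infdist (g (p, x)) C < infdist x (\<Gamma> p)" for k
  proof (rule ccontr)
    assume "\<not> ?thesis"
    moreover have "\<Gamma> p \<noteq> {}" if "p \<in> P \<inter> ball pb (d k)" for p
      using near[of p] that by (auto simp: d_def)
    ultimately have "\<forall>p\<in>P \<inter> ball pb (d k). \<forall>x\<in>ball xb (d k).
        \<Gamma> p \<noteq> {} \<and> infdist x (\<Gamma> p) \<le> real (Suc k) * infdist (g (p, x)) C"
      by (metis linorder_not_less)
    moreover have "(0::real) \<le> real (Suc k)" by simp
    ultimately show False using contra d0 by blast
  qed
  then obtain p x where p: "\<And>k. p k \<in> P \<inter> ball pb (d k)" and x: "\<And>k. x k \<in> ball xb (d k)"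
    and far: "\<And>k. real (Suc k) * infdist (g (p k, x k)) C < infdist (x k) (\<Gamma> (p k))"
    by metis
  define z where "z k = (p k, x k)" for k
  \<comment> \<open>The scale measures parameter and variable jointly. The case
    \<open>p k = pb\<close> is thus included: the limit \<open>w\<close> may be 0, and only the pair
    \<open>(w, u)\<close> is nonzero.\<close>
  define t where "t k = norm (z k - (pb, xb))" for k
  have pt: "dist pb (p k) \<le> t k" and xt: "dist (x k) xb \<le> t k" for k
    using norm_fst_le[of "p k - pb" "x k - xb"] norm_snd_le[of "x k - xb" "p k - pb"]
    by (auto simp: t_def z_def dist_norm norm_minus_commute)
  have inf_le: "infdist (x k) (\<Gamma> (p k)) \<le> (1 + c) * t k" for k
  proof -
    obtain x' where x': "x' \<in> \<Gamma> (p k)" "dist xb x' \<le> c * dist pb (p k)"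
      using near[of "p k"] p[of k] by (auto simp: d_def)
    have "infdist (x k) (\<Gamma> (p k)) \<le> dist (x k) x'" by (rule infdist_le[OF x'(1)])
    also have "\<dots> \<le> dist (x k) xb + dist xb x'" by (rule dist_triangle)
    also have "\<dots> \<le> t k + c * t k"
      using x'(2) xt[of k] mult_left_mono[OF pt[of k] c] by linarith
    finally show ?thesis by (simp add: algebra_simps)
  qed
  have \<delta>nn: "infdist (g (p k, x k)) C \<ge> 0" for k by (rule infdist_nonneg)
  have t: "t k > 0" for k
  proof -
    have "infdist (x k) (\<Gamma> (p k)) > 0"
      using far[of k] mult_nonneg_nonneg[OF of_nat_0_le_iff \<delta>nn[of k], of "Suc k"] by linarith
    hence "(1 + c) * t k > 0" using inf_le[of k] by linarith
    thus ?thesis using c by (simp add: zero_less_mult_iff)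
  qed
  have infeas: "g (p k, x k) \<notin> C" for k
    using far[of k] \<delta>nn[of k] by (auto intro: order.strict_implies_not_eq)
  have \<delta>0: "infdist (g (p k, x k)) C > 0" for k
    using infeas[of k] \<delta>nn[of k] by (metis closed_C C_nonempty in_closed_iff_infdist_zero less_eq_real_def)
  have dlim: "d \<longlonglongrightarrow> 0"
    by (rule real_tendsto_sandwich[OF _ _ tendsto_const LIMSEQ_Suc[OF lim_1_over_n]])
       (use d0 in \<open>auto simp: d_def intro: always_eventually less_imp_le\<close>)
  have "t k \<le> 2 * d k" for k
    using norm_Pair_le[of "p k - pb" "x k - xb"] p[of k] x[of k]
    by (simp add: t_def z_def dist_norm norm_minus_commute)
  hence t0: "t \<longlonglongrightarrow> 0"
    by (intro real_tendsto_sandwich[OF _ _ tendsto_const tendsto_mult_right_zero[OF dlim]])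
       (use t in \<open>auto intro: always_eventually less_imp_le\<close>)
  have "norm ((z k - (pb, xb)) /\<^sub>R t k) = 1" for k using t[of k] by (simp add: t_def)
  then obtain wu s where wu1: "norm wu = 1" and s: "strict_mono s"
    and wu: "(\<lambda>k. (z (s k) - (pb, xb)) /\<^sub>R t (s k)) \<longlonglongrightarrow> wu"
    by (rule unit_sequence_convergent_subsequence)
  have inv: "(\<lambda>k. inverse (real (Suc k))) \<longlonglongrightarrow> 0" by (rule LIMSEQ_inverse_real_of_nat)
  have \<delta>t: "(\<lambda>k. infdist (g (p k, x k)) C / t k) \<longlonglongrightarrow> 0"
  proof (rule real_tendsto_sandwich[OF always_eventually always_eventually tendsto_const
        tendsto_mult_right_zero[OF inv, of "1 + c"]]; intro allI)
    fix k
    show "0 \<le> infdist (g (p k, x k)) C / t k" using t[of k] \<delta>nn[of k] by simp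
    have "real (Suc k) * infdist (g (p k, x k)) C \<le> (1 + c) * t k"
      using far[of k] inf_le[of k] by linarith
    thus "infdist (g (p k, x k)) C / t k \<le> (1 + c) * inverse (real (Suc k))"
      using t[of k] by (simp add: field_simps del: of_nat_Suc)
  qed
  define R where "R k = real (Suc k) * infdist (g (p k, x k)) C" for k
  have \<delta>R: "(\<lambda>k. infdist (g (p k, x k)) C / R k) \<longlonglongrightarrow> 0"
    using inv \<delta>0 by (simp add: R_def less_imp_neq[symmetric] inverse_eq_divide del: of_nat_Suc)
  show False
  proof (rule no_infeasible_tangential_sequence)
    show "p (s k) \<in> P" for k using p by blast
    show "t (s k) > 0" for k by (rule t)
    show "(\<lambda>k. t (s k)) \<longlonglongrightarrow> 0" using LIMSEQ_subseq_LIMSEQ[OF t0 s] by (simp add: comp_def)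
    show "(\<lambda>k. (p (s k) - pb) /\<^sub>R t (s k)) \<longlonglongrightarrow> fst wu"
      using tendsto_fst[OF wu] by (simp add: z_def)
    show "(\<lambda>k. (x (s k) - xb) /\<^sub>R t (s k)) \<longlonglongrightarrow> snd wu"
      using tendsto_snd[OF wu] by (simp add: z_def)
    show "(fst wu, snd wu) \<noteq> (0, 0)" using wu1 by (cases wu) (auto simp: zero_prod_def)
    show "R (s k) > 0" for k using \<delta>0 by (simp add: R_def)
    show "(\<lambda>k. infdist (g (p (s k), x (s k))) C / t (s k)) \<longlonglongrightarrow> 0"
      using LIMSEQ_subseq_LIMSEQ[OF \<delta>t s] by (simp add: comp_def)
    show "(\<lambda>k. infdist (g (p (s k), x (s k))) C / R (s k)) \<longlonglongrightarrow> 0"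
      using LIMSEQ_subseq_LIMSEQ[OF \<delta>R s] by (simp add: comp_def)
    fix k x' assume x': "x' \<in> cball (x (s k)) (R (s k))"
    show "g (p (s k), x') \<notin> C"
    proof
      assume "g (p (s k), x') \<in> C"
      hence "infdist (x (s k)) (\<Gamma> (p (s k))) \<le> dist (x (s k)) x'" by (intro infdist_le) simp
      thus False using x' far[of "s k"] by (simp add: R_def)
    qed
  qed
qed

section \<open>Robinson stability and the Lipschitz-like property\<close>

text \<open>The operator norm of \<open>D z\<close> is at most the sum of
  \<open>norm (D z b)\<close> over basis vectors. Continuity of \<open>D z h\<close> in
  \<open>z\<close> for each fixed \<open>h\<close> therefore bounds it on compact balls, and the
  mean value inequality applies by convexity.\<close>

lemma locally_lipschitz: "\<exists>M\<ge>0. \<forall>z\<in>cball z0 r. \<forall>z'\<in>cball z0 r. dist (g z) (g z') \<le> M * dist z z'"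
proof -
  have "continuous_on (cball z0 r) (\<lambda>z. \<Sum>b\<in>Basis. norm (D z b))"
    by (intro continuous_intros continuous_on_subset[OF cont_der]) auto
  hence "bounded ((\<lambda>z. \<Sum>b\<in>Basis. norm (D z b)) ` cball z0 r)"
    by (intro compact_imp_bounded compact_continuous_image) auto
  then obtain M where M: "M > 0" "\<And>z. z \<in> cball z0 r \<Longrightarrow> norm (\<Sum>b\<in>Basis. norm (D z b)) \<le> M"
    unfolding bounded_pos by auto
  have "onorm (D z) \<le> M" if "z \<in> cball z0 r" for z
    using onorm_componentwise[OF has_derivative_bounded_linear[OF has_der[of z]]] M(2)[OF that] by simp
  hence "dist (g z) (g z') \<le> M * dist z z'" if "z \<in> cball z0 r" "z' \<in> cball z0 r" for z z'
    unfolding dist_norm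
    using that by (intro differentiable_bound[OF convex_cball has_derivative_at_withinI[OF has_der]]) auto
  thus ?thesis using M(1) by (intro exI[of _ M]) auto
qed

lemma robinson_stable: "robinson_stable (\<lambda>p x. g (p, x)) C P pb xb"
proof -
  obtain \<kappa> e where "\<kappa> \<ge> 0" "e > 0" and "\<forall>p\<in>P \<inter> ball pb e. \<forall>x\<in>ball xb e.
     \<Gamma> p \<noteq> {} \<and> infdist x (\<Gamma> p) \<le> \<kappa> * infdist (g (p, x)) C"
    using uniform_error_bound by blast
  thus ?thesis
    unfolding robinson_stable_def
    by (intro exI[of _ \<kappa>] conjI exI[of _ "ball pb e"] exI[of _ "ball xb e"]) auto
qed

text \<open>A point feasible for \<open>p\<close> has residual at most \<open>M * dist p p'\<close>
  in the system for \<open>p'\<close>. The error bound at \<open>p'\<close> converts this residual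
  into a distance to the solution set.\<close>

lemma lipschitz_like: "lipschitz_like \<Gamma> P pb xb"
proof -
  obtain \<kappa> e where \<kappa>: "\<kappa> \<ge> 0" and e: "e > 0" and eb: "\<forall>p\<in>P \<inter> ball pb e. \<forall>x\<in>ball xb e.
     \<Gamma> p \<noteq> {} \<and> infdist x (\<Gamma> p) \<le> \<kappa> * infdist (g (p, x)) C"
    using uniform_error_bound by blast
  obtain M where M: "M \<ge> 0" "\<And>z z'. \<lbrakk>z \<in> cball (pb, xb) (2 * e); z' \<in> cball (pb, xb) (2 * e)\<rbrakk>
      \<Longrightarrow> dist (g z) (g z') \<le> M * dist z z'"
    using locally_lipschitz by blast
  \<comment> \<open>The product norm is at most the sum of the component norms, hence the radius
    \<open>2 * e\<close>.\<close>
  have in_ball: "(p, x) \<in> cball (pb, xb) (2 * e)" if "p \<in> ball pb e" "x \<in> ball xb e" for p x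
    using norm_Pair_le[of "pb - p" "xb - x"] that by (simp add: dist_norm)
  have "\<exists>x'\<in>\<Gamma> p'. dist x x' \<le> (\<kappa> * M) * dist p p'"
    if p: "p \<in> ball pb e \<inter> P" and p': "p' \<in> ball pb e \<inter> P" and x: "x \<in> \<Gamma> p \<inter> ball xb e" for p p' x
  proof -
    have ne: "\<Gamma> p' \<noteq> {}" and le: "infdist x (\<Gamma> p') \<le> \<kappa> * infdist (g (p', x)) C"
      using eb p' x by auto
    \<comment> \<open>Closedness of the solution set turns the infimum into an actual point,
      avoiding any loss in the constant.\<close>
    obtain x' where x': "x' \<in> \<Gamma> p'" "infdist x (\<Gamma> p') = dist x x'"
      using infdist_attains_inf[OF closed_\<Gamma> ne] by blast
    have "infdist (g (p', x)) C \<le> dist (g (p', x)) (g (p, x))" using x by (intro infdist_le) auto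
    also have "\<dots> \<le> M * dist (p', x) (p, x)" using p p' x by (intro M in_ball) auto
    also have "dist (p', x) (p, x) = dist p p'" by (simp add: dist_Pair_Pair dist_commute)
    finally have "\<kappa> * infdist (g (p', x)) C \<le> \<kappa> * (M * dist p p')" using \<kappa> by (rule mult_left_mono)
    thus ?thesis using le x' by (intro bexI[OF _ x'(1)]) (simp add: mult.assoc)
  qed
  thus ?thesis
    unfolding lipschitz_like_def using \<kappa> M(1) e
    by (intro exI[of _ "\<kappa> * M"] conjI exI[of _ "ball pb e"] exI[of _ "ball xb e"]) auto
qed

end

section \<open>The complementarity set\<close>

text \<open>This finite sum is what allows the adjoint term in \<open>Gmap\<close> to be
  differentiated by the product rule.\<close>

lemma adjoint_eq_sum_Basis:
  fixes f :: "'a::euclidean_space \<Rightarrow> 'b::euclidean_space"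
  assumes "linear f"
  shows "adjoint f y = (\<Sum>b\<in>Basis. inner y (f b) *\<^sub>R b)"
  by (rule euclidean_eqI)
     (simp add: adjoint_clauses(2)[OF assms])

section \<open>Tangents and normals of product sets\<close>

lemma snd_contingent_cone_Times:
  assumes "w \<in> contingent_cone (S \<times> T) z"
  shows "snd w \<in> contingent_cone T (snd z)"
proof -
  obtain t wk where "\<forall>k. t k > 0" "t \<longlonglongrightarrow> 0" "wk \<longlonglongrightarrow> w" "\<forall>k. z + t k *\<^sub>R wk k \<in> S \<times> T"
    using assms unfolding contingent_cone_def by blast
  thus ?thesis
    unfolding contingent_cone_def
    by (intro CollectI exI[of _ t] exI[of _ "\<lambda>k. snd (wk k)"])
       (auto intro!: tendsto_snd simp: mem_Times_iff)
qed

text \<open>All approximating directions have first component exactly 0, so the limit does too. For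
  \<open>Cset\<close> this yields the linearized equation contained in the tangency
  condition.\<close>

lemma contingent_cone_singleton_0_Times:
  assumes "w \<in> contingent_cone ({0} \<times> T) (0, y)"
  shows "fst w = 0"
proof -
  obtain t wk where t: "\<forall>k. t k > 0" and w: "wk \<longlonglongrightarrow> w" and "\<forall>k. (0, y) + t k *\<^sub>R wk k \<in> {0} \<times> T"
    using assms unfolding contingent_cone_def by blast
  hence "fst (wk k) = 0" for k by (metis add_0 fst_add fst_conv fst_scaleR mem_Times_iff
        order_less_irrefl scaleR_eq_0_iff singletonD)
  thus ?thesis using tendsto_fst[OF w] by (simp add: LIMSEQ_const_iff)
qed

text \<open>The normal inequality is tested only at points whose first component is that of
  \<open>z\<close>; they lie in the product, and the first component then contributes neither to the
  inner product nor to the norm.\<close>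

lemma snd_regular_normal_cone_Times:
  assumes v: "v \<in> regular_normal_cone (S \<times> T) z"
  shows "snd v \<in> regular_normal_cone T (snd z)"
  unfolding regular_normal_cone_def
proof (intro CollectI conjI allI impI)
  show "snd z \<in> T" using v by (auto simp: regular_normal_cone_def)
  fix \<epsilon> :: real assume "\<epsilon> > 0"
  then obtain \<delta> where "\<delta> > 0" and \<delta>: "\<And>z'. \<lbrakk>z' \<in> S \<times> T; dist z' z < \<delta>\<rbrakk>
      \<Longrightarrow> inner v (z' - z) \<le> \<epsilon> * norm (z' - z)"
    using v unfolding regular_normal_cone_def by blast
  moreover have "fst z \<in> S" using v by (auto simp: regular_normal_cone_def)
  ultimately show "\<exists>\<delta>>0. \<forall>y\<in>T. dist y (snd z) < \<delta>
      \<longrightarrow> inner (snd v) (y - snd z) \<le> \<epsilon> * norm (y - snd z)"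
    using \<delta>[of "(fst z, y)" for y]
    by (intro exI[of _ \<delta>])
       (auto simp: inner_prod_def norm_prod_def dist_prod_def)
qed

lemma snd_dir_limiting_normal_cone_Times:
  assumes "v \<in> dir_limiting_normal_cone (S \<times> T) z w"
  shows "snd v \<in> dir_limiting_normal_cone T (snd z) (snd w)"
proof -
  obtain t wk vk where "\<forall>k. t k > 0" "t \<longlonglongrightarrow> 0" "wk \<longlonglongrightarrow> w" "vk \<longlonglongrightarrow> v"
    and z: "\<forall>k. z + t k *\<^sub>R wk k \<in> S \<times> T \<and> vk k \<in> regular_normal_cone (S \<times> T) (z + t k *\<^sub>R wk k)"
    using assms unfolding dir_limiting_normal_cone_def by blast
  moreover have "snd z + t k *\<^sub>R snd (wk k) \<in> T" for k using z by (auto simp: mem_Times_iff)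
  moreover have "snd (vk k) \<in> regular_normal_cone T (snd z + t k *\<^sub>R snd (wk k))" for k
    using snd_regular_normal_cone_Times[of "vk k" S T "z + t k *\<^sub>R wk k"] z by simp
  ultimately show ?thesis
    unfolding dir_limiting_normal_cone_def
    by (intro CollectI exI[of _ t] exI[of _ "\<lambda>k. snd (wk k)"] exI[of _ "\<lambda>k. snd (vk k)"])
       (auto intro!: tendsto_snd)
qed

section \<open>Polyhedrality of the complementarity set\<close>

text \<open>In the plane the complementarity set is the union of two half-lines meeting at the
  origin. Away from the origin, nearby feasible points stay on the same half-line, so the
  transversal tangent component vanishes. At the origin the set is a closed cone and contains its
  own tangents.\<close>

lemma complementarity_tangent_imp_feasible_ray:
  fixes a b \<alpha> \<beta> :: real
  assumes t: "\<And>k. t k > 0" "t \<longlonglongrightarrow> 0" and lim: "\<alpha>k \<longlonglongrightarrow> \<alpha>" "\<beta>k \<longlonglongrightarrow> \<beta>"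
    and feas: "\<And>k. a + t k * \<alpha>k k \<le> 0 \<and> b + t k * \<beta>k k \<ge> 0 \<and> (a + t k * \<alpha>k k) * (b + t k * \<beta>k k) = 0"
  shows "\<forall>\<^sub>F t in at_right 0. a + t * \<alpha> \<le> 0 \<and> b + t * \<beta> \<ge> 0 \<and> (a + t * \<alpha>) * (b + t * \<beta>) = 0"
proof -
  have alim: "(\<lambda>k. a + t k * \<alpha>k k) \<longlonglongrightarrow> a + 0 * \<alpha>" and blim: "(\<lambda>k. b + t k * \<beta>k k) \<longlonglongrightarrow> b + 0 * \<beta>"
    by (intro tendsto_intros t lim)+
  have a: "a \<le> 0" using LIMSEQ_le_const2[OF alim] feas by auto
  have b: "b \<ge> 0" using LIMSEQ_le_const[OF blim] feas by auto
  have "(\<lambda>k. (a + t k * \<alpha>k k) * (b + t k * \<beta>k k)) \<longlonglongrightarrow> (a + 0 * \<alpha>) * (b + 0 * \<beta>)"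
    by (rule tendsto_mult[OF alim blim])
  hence ab: "a * b = 0" using feas by (simp add: LIMSEQ_const_iff)
  have near: "((\<lambda>t. c + t * \<gamma>) \<longlongrightarrow> c + 0 * \<gamma>) (at_right 0)" for c \<gamma> :: real
    by (intro tendsto_intros)
  consider "a < 0" "b = 0" | "a = 0" "b > 0" | "a = 0" "b = 0" using a b ab by force
  thus ?thesis
  proof cases
    case 1
    have "\<forall>\<^sub>F k in sequentially. a + t k * \<alpha>k k < 0" using order_tendstoD(2)[OF alim, of 0] 1 by simp
    \<comment> \<open>Once the first factor is negative, complementarity forces
      \<open>t k * \<beta>k k = 0\<close>.\<close>
    hence "\<forall>\<^sub>F k in sequentially. \<beta>k k = 0"
      by eventually_elim (use feas t(1) 1 in \<open>metis add_0 less_irrefl mult_eq_0_iff\<close>)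
    hence "\<beta> = 0" using lim(2) by (metis tendsto_eventually LIMSEQ_unique)
    moreover have "\<forall>\<^sub>F t in at_right 0. a + t * \<alpha> < 0" using order_tendstoD(2)[OF near, of a \<alpha> 0] 1 by simp
    ultimately show ?thesis using 1 by (auto elim: eventually_mono)
  next
    case 2
    have "\<forall>\<^sub>F k in sequentially. b + t k * \<beta>k k > 0" using order_tendstoD(1)[OF blim, of 0] 2 by simp
    hence "\<forall>\<^sub>F k in sequentially. \<alpha>k k = 0"
      by eventually_elim (use feas t(1) 2 in \<open>metis add_0 less_irrefl mult_eq_0_iff\<close>)
    hence "\<alpha> = 0" using lim(1) by (metis tendsto_eventually LIMSEQ_unique)
    moreover have "\<forall>\<^sub>F t in at_right 0. b + t * \<beta> > 0" using order_tendstoD(1)[OF near, of 0 b \<beta>] 2 by simp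
    ultimately show ?thesis using 2 by (auto elim: eventually_mono)
  next
    case 3
    \<comment> \<open>With both base coordinates 0, the positive factor \<open>t k\<close> can be
      cancelled from all three conditions.\<close>
    have sgn: "\<alpha>k k \<le> 0 \<and> \<beta>k k \<ge> 0 \<and> \<alpha>k k * \<beta>k k = 0" for k
      using feas[of k] t(1)[of k] 3 by (auto simp: mult_le_0_iff zero_le_mult_iff)
    have "\<alpha> \<le> 0" using LIMSEQ_le_const2[OF lim(1)] sgn by auto
    moreover have "\<beta> \<ge> 0" using LIMSEQ_le_const[OF lim(2)] sgn by auto
    moreover have "\<alpha> * \<beta> = 0" using tendsto_mult[OF lim] sgn by (simp add: LIMSEQ_const_iff)
    ultimately show ?thesis
      using 3 eventually_at_right_less[of "0::real"]
      by (auto elim!: eventually_mono simp: mult_le_0_iff)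
  qed
qed

text \<open>The coordinate pairs decouple, and since there are finitely many of them, one step bound
  serves all. This is what provides the ray in \<open>linearized_solvable\<close>.\<close>

lemma gph_N_nonpos_tangent_imp_feasible_ray:
  assumes "w \<in> contingent_cone gph_N_nonpos z"
  shows "\<forall>\<^sub>F t in at_right 0. z + t *\<^sub>R w \<in> gph_N_nonpos"
proof -
  obtain t wk where t: "\<And>k. t k > 0" "t \<longlonglongrightarrow> 0" and wk: "wk \<longlonglongrightarrow> w"
    and feas: "\<And>k. z + t k *\<^sub>R wk k \<in> gph_N_nonpos"
    using assms unfolding contingent_cone_def by blast
  have "\<forall>\<^sub>F t in at_right 0. \<forall>i. fst z $ i + t * fst w $ i \<le> 0 \<and> snd z $ i + t * snd w $ i \<ge> 0
      \<and> (fst z $ i + t * fst w $ i) * (snd z $ i + t * snd w $ i) = 0"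
  proof (rule eventually_all_finite)
    fix i
    show "\<forall>\<^sub>F t in at_right 0. fst z $ i + t * fst w $ i \<le> 0 \<and> snd z $ i + t * snd w $ i \<ge> 0
      \<and> (fst z $ i + t * fst w $ i) * (snd z $ i + t * snd w $ i) = 0"
    proof (rule complementarity_tangent_imp_feasible_ray[OF t])
      show "(\<lambda>k. fst (wk k) $ i) \<longlonglongrightarrow> fst w $ i" "(\<lambda>k. snd (wk k) $ i) \<longlonglongrightarrow> snd w $ i"
        by (intro tendsto_intros wk)+
    qed (use feas in \<open>auto simp: gph_N_nonpos_def case_prod_beta\<close>)
  qed
  thus ?thesis by (auto simp: gph_N_nonpos_def case_prod_beta elim: eventually_mono)
qed

lemma closed_gph_N_nonpos: "closed gph_N_nonpos"
  unfolding gph_N_nonpos_def case_prod_beta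
  by (intro closed_Collect_all closed_Collect_conj closed_Collect_le closed_Collect_eq continuous_intros)

lemma closed_Cset: "closed Cset"
  unfolding Cset_def by (intro closed_Times closed_gph_N_nonpos closed_singleton)

section \<open>The variational system\<close>

lemma grad_x_eq:
  assumes "(f has_derivative f') (at (p, x))"
  shows "grad_x f p x = (\<lambda>u. f' (0, u))"
  using frechet_derivative_at[OF assms] by (simp add: grad_x_def)

lemma linear_grad_x:
  assumes "f differentiable at (p, x)"
  shows "linear (grad_x f p x)"
proof -
  have "linear (\<lambda>u. (0, u))" by (rule linearI) auto
  from linear_compose[OF this linear_frechet_derivative[OF assms]]
  show ?thesis by (simp add: grad_x_def comp_def)
qed

text \<open>Written as a basis sum, the adjoint term is a sum of products of \<open>y\<close> with
  first derivatives of \<phi>, which are continuously differentiable because \<phi> is twice so. As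
  \<open>Gmap\<close> is affine in \<open>y\<close>, its derivative in that variable is the adjoint
  itself.\<close>

lemma Gmap_C1:
  fixes F :: "(real^'m) \<times> (real^'n) \<Rightarrow> (real^'n)" and \<phi> :: "(real^'m) \<times> (real^'n) \<Rightarrow> (real^'l)"
  assumes F: "C1_map F" and \<phi>: "C2_map \<phi>"
  obtains DG where "\<And>z. (Gmap F \<phi> has_derivative DG z) (at z)"
    and "\<And>h. continuous_on UNIV (\<lambda>z. DG z h)"
    and "\<And>p x y v. DG (p, x, y) (0, 0, v) = adjoint (grad_x \<phi> p x) v"
proof -
  obtain DF where DF: "\<And>z. (F has_derivative blinfun_apply (DF z)) (at z)"
    and cDF: "continuous_on UNIV DF"
    using F unfolding C1_map_def by blast
  obtain D\<phi> D2\<phi> where D\<phi>: "\<And>z. (\<phi> has_derivative blinfun_apply (D\<phi> z)) (at z)"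
    and D2\<phi>: "\<And>z. (D\<phi> has_derivative blinfun_apply (D2\<phi> z)) (at z)"
    and cD2\<phi>: "continuous_on UNIV D2\<phi>"
    using \<phi> unfolding C2_map_def by blast
  have cD\<phi>: "continuous_on UNIV D\<phi>"
    using D2\<phi> has_derivative_continuous by (metis continuous_at_imp_continuous_on)
  define \<pi> where "\<pi> = (\<lambda>z::(real^'m) \<times> (real^'n) \<times> (real^'l). (fst z, fst (snd z)))"
  \<comment> \<open>Inside the sum, the product rule gives one term differentiating the first
    derivative of \<phi> and one differentiating \<open>y\<close>.\<close>
  define DG where "DG = (\<lambda>z h. DF (\<pi> z) (\<pi> h) + (\<Sum>b\<in>Basis. (inner (snd (snd z)) (D2\<phi> (\<pi> z) (\<pi> h) (0, b))
      + inner (snd (snd h)) (D\<phi> (\<pi> z) (0, b))) *\<^sub>R b))"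
  have adj: "adjoint (grad_x \<phi> p x) y = (\<Sum>b\<in>Basis. inner y (D\<phi> (p, x) (0, b)) *\<^sub>R b)" for p x y
  proof -
    have "linear (grad_x \<phi> p x)" by (rule linear_grad_x) (use D\<phi> in \<open>auto simp: differentiable_def\<close>)
    thus ?thesis using grad_x_eq[OF D\<phi>, of p x] by (simp add: adjoint_eq_sum_Basis)
  qed
  have G: "Gmap F \<phi> = (\<lambda>z. F (\<pi> z) + (\<Sum>b\<in>Basis. inner (snd (snd z)) (D\<phi> (\<pi> z) (0, b)) *\<^sub>R b))"
    by (auto simp: Gmap_def adj \<pi>_def fun_eq_iff)
  have \<pi>': "(\<pi> has_derivative \<pi>) (at z)" for z
    unfolding \<pi>_def by (auto intro!: derivative_eq_intros)
  have D\<phi>\<pi>: "((\<lambda>z. D\<phi> (\<pi> z) h) has_derivative (\<lambda>k. D2\<phi> (\<pi> z) (\<pi> k) h)) (at z)" for z h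
    by (rule bounded_linear.has_derivative[OF blinfun.bounded_linear_left
          has_derivative_compose[OF \<pi>' D2\<phi>]])
  have c\<pi>: "continuous_on UNIV \<pi>" unfolding \<pi>_def by (intro continuous_intros)
  show ?thesis
  proof
    show "(Gmap F \<phi> has_derivative DG z) (at z)" for z
      unfolding G DG_def
      by (intro has_derivative_add has_derivative_sum has_derivative_scaleR_left has_derivative_inner
          has_derivative_compose[OF \<pi>' DF] D\<phi>\<pi> has_derivative_snd has_derivative_ident)
    show "continuous_on UNIV (\<lambda>z. DG z h)" for h
      unfolding DG_def
      by (intro continuous_intros continuous_on_compose2[OF cDF c\<pi>] continuous_on_compose2[OF cD\<phi> c\<pi>]
          continuous_on_compose2[OF cD2\<phi> c\<pi>]) auto
    \<comment> \<open>A pure \<open>y\<close>-increment does not move \<open>(p, x)\<close>, so only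
      the terms differentiating \<open>y\<close> survive in \<open>DG\<close>.\<close>
    have "\<pi> (0, 0, v) = 0" for v by (simp add: \<pi>_def zero_prod_def)
    moreover have "\<pi> (p, x, y) = (p, x)" for p x y by (simp add: \<pi>_def)
    ultimately show "DG (p, x, y) (0, 0, v) = adjoint (grad_x \<phi> p x) v" for p x y v
      by (simp add: DG_def adj)
  qed
qed

theorem theorem5p2:
  fixes P :: "(real^'m) set" and pb :: "(real^'m)"
    and F :: "(real^'m) \<times> (real^'n) \<Rightarrow> (real^'n)"
    and \<phi> :: "(real^'m) \<times> (real^'n) \<Rightarrow> (real^'l)"
    and xb :: "(real^'n)" and yb :: "(real^'l)"
  assumes pbP: "pb \<in> P"
    and F_C1: "C1_map F"
    and phi_C2: "C2_map \<phi>"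
    and feas: "(xb, yb) \<in> Gamma_map F \<phi> pb"
    and cond1: "\<forall>w\<in>contingent_cone P pb. \<exists>u v.
        frechet_derivative (Gmap F \<phi>) (at (pb, xb, yb)) (w, 0, 0)
        + frechet_derivative (Gmap F \<phi>) (at (pb, xb, yb)) (0, u, 0)
        + adjoint (grad_x \<phi> pb xb) v = 0
        \<and> (frechet_derivative \<phi> (at (pb, xb)) (w, u), v)
            \<in> contingent_cone gph_N_nonpos (\<phi> (pb, xb), yb)"
    and cond2: "\<forall>w u v. (w, u, v) \<noteq> (0, 0, 0) \<and> w \<in> contingent_cone P pb
        \<and> frechet_derivative (Gmap F \<phi>) (at (pb, xb, yb)) (w, 0, 0)
          + frechet_derivative (Gmap F \<phi>) (at (pb, xb, yb)) (0, u, 0)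
          + adjoint (grad_x \<phi> pb xb) v = 0
        \<and> (frechet_derivative \<phi> (at (pb, xb)) (w, u), v)
            \<in> contingent_cone gph_N_nonpos (\<phi> (pb, xb), yb)
        \<longrightarrow> (\<forall>z lam d.
              adjoint (\<lambda>u'. frechet_derivative (Gmap F \<phi>) (at (pb, xb, yb)) (0, u', 0)) z
                + adjoint (grad_x \<phi> pb xb) lam = 0
              \<and> grad_x \<phi> pb xb z + d = 0
              \<and> (lam, d) \<in> dir_limiting_normal_cone gph_N_nonpos (\<phi> (pb, xb), yb)
                   (frechet_derivative \<phi> (at (pb, xb)) (w, u), v)
              \<longrightarrow> z = 0 \<and> lam = 0)"
  shows "robinson_stable (gmap F \<phi>) Cset P pb (xb, yb)
    \<and> lipschitz_like (Gamma_map F \<phi>) P pb (xb, yb)"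
proof -
  obtain DG where DG: "\<And>z. (Gmap F \<phi> has_derivative DG z) (at z)"
    and cDG: "\<And>h. continuous_on UNIV (\<lambda>z. DG z h)"
    and DG_y: "\<And>p x y v. DG (p, x, y) (0, 0, v) = adjoint (grad_x \<phi> p x) v"
    using Gmap_C1[OF F_C1 phi_C2] by metis
  obtain D\<phi> D2\<phi> where D\<phi>: "\<And>z. (\<phi> has_derivative blinfun_apply (D\<phi> z)) (at z)"
    and D2\<phi>: "\<And>z. (D\<phi> has_derivative blinfun_apply (D2\<phi> z)) (at z)"
    using phi_C2 unfolding C2_map_def by blast
  have cD\<phi>: "continuous_on UNIV D\<phi>"
    using D2\<phi> has_derivative_continuous by (metis continuous_at_imp_continuous_on)
  have fG: "frechet_derivative (Gmap F \<phi>) (at z) = DG z" for z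
    using frechet_derivative_at[OF DG] by simp
  have f\<phi>: "frechet_derivative \<phi> (at z) = blinfun_apply (D\<phi> z)" for z
    using frechet_derivative_at[OF D\<phi>] by simp
  have grad: "grad_x \<phi> pb xb = (\<lambda>u. D\<phi> (pb, xb) (0, u))" by (rule grad_x_eq[OF D\<phi>])
  have lin_grad: "linear (grad_x \<phi> pb xb)"
    by (rule linear_grad_x) (use D\<phi> in \<open>auto simp: differentiable_def\<close>)
  define zb where "zb = (pb, xb, yb)"
  have lin_DG: "linear (DG zb)" using DG by (rule has_derivative_linear)
  \<comment> \<open>This identifies the sum of three partial derivatives in the hypotheses with a
    single total derivative, so the linearized equation reads
    \<open>DG zb (w, u, v) = 0\<close>.\<close>
  have DG_split: "DG zb (w, u, v) = DG zb (w, 0, 0) + DG zb (0, u, 0) + adjoint (grad_x \<phi> pb xb) v" for w u v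
  proof -
    have "DG zb (w, u, v) = DG zb ((w, 0, 0) + (0, u, 0) + (0, 0, v))" by simp
    also have "\<dots> = DG zb (w, 0, 0) + DG zb (0, u, 0) + DG zb (0, 0, v)"
      by (simp only: linear_add[OF lin_DG])
    finally show ?thesis using DG_y[of pb xb yb v] by (simp add: zb_def)
  qed
  have lin_DGx: "linear (\<lambda>u. DG zb (0, u, 0))"
  proof -
    have "linear (\<lambda>u::real^'n. (0::real^'m, u, 0::real^'l))" by (rule linearI) auto
    from linear_compose[OF this lin_DG] show ?thesis by (simp add: comp_def)
  qed
  define g where "g = (\<lambda>z. (Gmap F \<phi> z, (\<phi> (fst z, fst (snd z)), snd (snd z))))"
  define Dg where "Dg = (\<lambda>z h. (DG z h, (D\<phi> (fst z, fst (snd z)) (fst h, fst (snd h)), snd (snd h))))"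
  have gmap_eq: "gmap F \<phi> = (\<lambda>p xi. g (p, xi))" by (auto simp: gmap_def g_def fun_eq_iff)
  have g_zb: "g zb = (0, (\<phi> (pb, xb), yb))" and gph_zb: "(\<phi> (pb, xb), yb) \<in> gph_N_nonpos"
    using feas by (auto simp: Gamma_map_def gmap_def Cset_def g_def zb_def)
  have Dg_zb: "Dg zb (w, u, v) = (DG zb (w, u, v), (D\<phi> (pb, xb) (w, u), v))" for w u v
    by (simp add: Dg_def zb_def)
  interpret C1_constraint_system g Dg Cset P pb "(xb, yb)"
  proof
    show "closed Cset" by (rule closed_Cset)
    show "(g has_derivative Dg z) (at z)" for z
    proof -
      have "((\<lambda>z. \<phi> (fst z, fst (snd z))) has_derivative
          (\<lambda>h. D\<phi> (fst z, fst (snd z)) (fst h, fst (snd h)))) (at z)"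
        by (rule has_derivative_compose[OF _ D\<phi>]) (auto intro!: derivative_eq_intros)
      thus ?thesis unfolding g_def Dg_def
        by (intro has_derivative_Pair DG has_derivative_snd has_derivative_ident)
    qed
    show "continuous_on UNIV (\<lambda>z. Dg z h)" for h
      unfolding Dg_def
      by (intro continuous_intros cDG continuous_on_compose2[OF cD\<phi>]) auto
    show "g (pb, xb, yb) \<in> Cset" using g_zb gph_zb by (simp add: zb_def Cset_def)
    show "\<exists>xi. \<forall>\<^sub>F t in at_right 0. g (pb, xb, yb) + t *\<^sub>R Dg (pb, xb, yb) (w, xi) \<in> Cset"
      if w: "w \<in> contingent_cone P pb" for w
    proof -
      obtain u v where 1: "DG zb (w, u, v) = 0"
        and 2: "(D\<phi> (pb, xb) (w, u), v) \<in> contingent_cone gph_N_nonpos (\<phi> (pb, xb), yb)"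
        using cond1[rule_format, OF w] unfolding fG f\<phi> zb_def[symmetric] DG_split[symmetric] by blast
      \<comment> \<open>Along the ray the first component remains 0 by the linearized equation; the
        remaining pair follows a feasible ray of the complementarity set.\<close>
      have "\<forall>\<^sub>F t in at_right 0. g zb + t *\<^sub>R Dg zb (w, u, v) \<in> Cset"
        using gph_N_nonpos_tangent_imp_feasible_ray[OF 2]
        by eventually_elim (simp add: g_zb Dg_zb 1 Cset_def)
      thus ?thesis by (auto simp: zb_def)
    qed
    show "l = 0" if wxi: "(w, xi) \<noteq> (0, 0)" and w: "w \<in> contingent_cone P pb"
      and tan: "Dg (pb, xb, yb) (w, xi) \<in> contingent_cone Cset (g (pb, xb, yb))"
      and normal: "l \<in> dir_limiting_normal_cone Cset (g (pb, xb, yb)) (Dg (pb, xb, yb) (w, xi))"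
      and orth: "\<And>xi'. inner l (Dg (pb, xb, yb) (0, xi')) = 0" for w xi l
    proof -
      obtain u v where xi: "xi = (u, v)" by (cases xi)
      obtain z lam d where l: "l = (z, lam, d)" by (cases l)
      have tan': "(DG zb (w, u, v), (D\<phi> (pb, xb) (w, u), v))
          \<in> contingent_cone ({0} \<times> gph_N_nonpos) (0, (\<phi> (pb, xb), yb))"
        using tan unfolding zb_def[symmetric] g_zb xi Dg_zb Cset_def .
      have 1: "DG zb (w, u, v) = 0" using contingent_cone_singleton_0_Times[OF tan'] by simp
      have 2: "(D\<phi> (pb, xb) (w, u), v) \<in> contingent_cone gph_N_nonpos (\<phi> (pb, xb), yb)"
        using snd_contingent_cone_Times[OF tan'] by simp
      have 3: "(lam, d) \<in> dir_limiting_normal_cone gph_N_nonpos (\<phi> (pb, xb), yb) (D\<phi> (pb, xb) (w, u), v)"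
        using snd_dir_limiting_normal_cone_Times[OF normal[unfolded Cset_def]]
        by (simp add: zb_def[symmetric] g_zb xi Dg_zb l)
      \<comment> \<open>Orthogonality to the partial derivative in \<open>(x, y)\<close> is the full
        adjoint system: \<open>v' = 0\<close> isolates the equation from \<open>x\<close>, and
        \<open>u' = 0\<close> the one from \<open>y\<close>.\<close>
      have orth': "inner z (DG zb (0, u', 0)) + inner z (adjoint (grad_x \<phi> pb xb) v')
          + inner lam (grad_x \<phi> pb xb u') + inner d v' = 0" for u' v'
        using orth[of "(u', v')"] linear_0[OF lin_DG] DG_split[of 0 u' v']
        unfolding zb_def[symmetric] Dg_zb l
        by (simp add: grad inner_add_right zero_prod_def)
      have 4: "adjoint (\<lambda>u. DG zb (0, u, 0)) z + adjoint (grad_x \<phi> pb xb) lam = 0"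
      proof (rule vector_eq_rdot[THEN iffD1, rule_format])
        fix u'
        show "inner (adjoint (\<lambda>u. DG zb (0, u, 0)) z + adjoint (grad_x \<phi> pb xb) lam) u' = inner 0 u'"
          using orth'[of u' 0]
          by (simp add: inner_add_left adjoint_clauses(2)[OF lin_DGx] adjoint_clauses(2)[OF lin_grad]
              adjoint_clauses(1)[OF lin_grad])
      qed
      have 5: "grad_x \<phi> pb xb z + d = 0"
      proof (rule vector_eq_rdot[THEN iffD1, rule_format])
        fix v'
        show "inner (grad_x \<phi> pb xb z + d) v' = inner 0 v'"
          using orth'[of 0 v'] linear_0[OF lin_DGx] linear_0[OF lin_grad]
          by (simp add: inner_add_left adjoint_clauses(1)[OF lin_grad])
      qed
      have "(w, u, v) \<noteq> (0, 0, 0)" using wxi by (auto simp: xi zero_prod_def)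
      moreover have "DG zb (w, 0, 0) + DG zb (0, u, 0) + adjoint (grad_x \<phi> pb xb) v = 0"
        using 1 unfolding DG_split[symmetric] .
      ultimately have "z = 0 \<and> lam = 0"
        using w 2 3 4 5 cond2 unfolding fG f\<phi> zb_def by blast
      \<comment> \<open>The qualification condition yields only \<open>z\<close> and
        \<open>lam\<close>; the component \<open>d\<close> vanishes because it equals minus the
        image of \<open>z\<close> under \<open>grad_x \<phi> pb xb\<close>.\<close>
      thus "l = 0" using 5 linear_0[OF lin_grad] by (simp add: l zero_prod_def)
    qed
  qed
  have "Gamma_map F \<phi> = (\<lambda>p. {xi. g (p, xi) \<in> Cset})"
    by (simp add: Gamma_map_def gmap_eq fun_eq_iff)
  thus ?thesis using robinson_stable lipschitz_like by (simp add: gmap_eq)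
qed

end
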